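(* Let $n\ge2$. If $M$ is a highest weight $L_{-1}(sp(2n))$-module in $\mathcal C_{-1}(sp(2n))$ with highest weight $-\Lambda_0$, then $M$ is irreducible.
   Context: $L_{-1}(sp(2n))$ is the simple affine vertex operator algebra associated to $sp(2n)$ at level $-1$ (form normalized so that the highest root has square length $2$). $\mathcal C_{-1}(sp(2n))$ is the category of grading-restricted generalized $L_{-1}(sp(2n))$-modules, i.e. modules $W=\bigoplus_{h\in\mathbb C}W_{[h]}$ graded by generalized $L(0)$-eigenspaces with $\dim W_{[h]}<\infty$ and, for each $h$, $W_{[h+m]}=0$ for $m\in\mathbb Z$ sufficiently negative. A highest weight module of highest weight $-\Lambda_0$ ($\Lambda_0$ the $0$-th fundamental weight of the affine Lie algebra) is one generated by a nonzero vector annihilated by the positive part of the affine Lie algebra (i.e. by $sp(2n)\otimes t\mathbb C[t]$ and the positive root vectors of $sp(2n)$), of $sp(2n)$-weight $0$, with the central element acting as $-1$. *)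

theory Defs
  imports "HOL-Analysis.Analysis" "HOL-Library.Groups_Big_Fun" "HOL-Library.Poly_Mapping"
begin

section \<open>Vertex operator algebras and their modules\<close>

text \<open>
  Complex vector spaces are whole types of class \<open>ab_group_add\<close> with an explicit scalar
  multiplication. The action is given by modes:
  \<open>act M u n\<close> is the coefficient $u_n$ in $Y_M(u,z) = \sum_n u_n z^{-n-1}$.
  A vertex operator algebra extends the record of its adjoint module, so \<open>V\<close> itself can be
  used wherever a \<open>V\<close>-module is expected.
\<close>

record ('v, 'w) voa_mod =
  scal :: "complex \<Rightarrow> 'w \<Rightarrow> 'w"
  act :: "'v \<Rightarrow> int \<Rightarrow> 'w \<Rightarrow> 'w"

record 'v voa = "('v, 'v) voa_mod" +
  vac :: 'v
  conf :: 'v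
  charge :: complex

definition virasoro_mode ::
    "'v voa \<Rightarrow> ('v, 'w, 'e) voa_mod_scheme \<Rightarrow> int \<Rightarrow> 'w \<Rightarrow> 'w" where
  "virasoro_mode V M n = act M (conf V) (n + 1)"

text \<open>
  The Jacobi identity, written as the equality of the coefficients of
  $z_0^{-l-1} z_1^{-m-1} z_2^{-n-1}$ on both sides. By lower truncation all but finitely many
  terms vanish.
\<close>

definition jacobi_identity ::
    "'v voa \<Rightarrow> ('v, 'w::ab_group_add, 'e) voa_mod_scheme \<Rightarrow> bool" where
  "jacobi_identity V M \<longleftrightarrow> (\<forall>u v w l m n.
     Sum_any (\<lambda>i::nat. scal M ((- 1) ^ i * (of_int l gchoose i))
       (act M u (m + l - int i) (act M v (n + int i) w)
        - scal M ((- 1) powi l) (act M v (n + l - int i) (act M u (m + int i) w))))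
     = Sum_any (\<lambda>i::nat. scal M (of_int m gchoose i)
         (act M (act V u (l + int i) v) (m + n - int i) w)))"

definition virasoro_relations ::
    "'v voa \<Rightarrow> ('v, 'w::ab_group_add, 'e) voa_mod_scheme \<Rightarrow> bool" where
  "virasoro_relations V M \<longleftrightarrow> (\<forall>m n w.
     virasoro_mode V M m (virasoro_mode V M n w) - virasoro_mode V M n (virasoro_mode V M m w)
     = scal M (of_int (m - n)) (virasoro_mode V M (m + n) w)
       + (if m + n = 0 then scal M (of_int (m ^ 3 - m) / 12 * charge V) w else 0))"

text \<open>The module axioms that do not concern the grading.\<close>

definition module_axioms ::
    "'v::ab_group_add voa \<Rightarrow> ('v, 'w::ab_group_add, 'e) voa_mod_scheme \<Rightarrow> bool" where
  "module_axioms V M \<longleftrightarrow>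
     vector_space (scal M) \<and>
     (\<forall>u n. Vector_Spaces.linear (scal M) (scal M) (act M u n)) \<and>
     (\<forall>n w. Vector_Spaces.linear (scal V) (scal M) (\<lambda>u. act M u n w)) \<and>
     (\<forall>u w. \<exists>N. \<forall>n\<ge>N. act M u n w = 0) \<and>
     (\<forall>n w. act M (vac V) n w = (if n = - 1 then w else 0)) \<and>
     jacobi_identity V M \<and>
     virasoro_relations V M \<and>
     (\<forall>u n w. act M (virasoro_mode V V (- 1) u) n w = scal M (- of_int n) (act M u (n - 1) w))"

definition weight_space :: "'v voa \<Rightarrow> complex \<Rightarrow> 'v set" where
  "weight_space V h = {v. virasoro_mode V V 0 v = scal V h v}"

definition gen_weight_space ::
    "'v voa \<Rightarrow> ('v, 'w::ab_group_add, 'e) voa_mod_scheme \<Rightarrow> complex \<Rightarrow> 'w set" where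
  "gen_weight_space V M h =
     {w. \<exists>N::nat. ((\<lambda>x. virasoro_mode V M 0 x - scal M h x) ^^ N) w = 0}"

definition finite_dim :: "(complex \<Rightarrow> 'w::ab_group_add \<Rightarrow> 'w) \<Rightarrow> 'w set \<Rightarrow> bool" where
  "finite_dim s W \<longleftrightarrow> (\<exists>B. finite B \<and> W \<subseteq> module.span s B)"

text \<open>
  Sums of (generalized) eigenspaces for distinct eigenvalues are automatically direct, so the
  gradings below only have to require that these spaces span.
\<close>

definition vertex_operator_algebra :: "'v::ab_group_add voa \<Rightarrow> bool" where
  "vertex_operator_algebra V \<longleftrightarrow>
     module_axioms V V \<and>
     (\<forall>v. act V v (- 1) (vac V) = v \<and> (\<forall>n\<ge>0. act V v n (vac V) = 0)) \<and>
     module.span (scal V) (\<Union>n::int. weight_space V (of_int n)) = UNIV \<and>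
     (\<forall>n::int. finite_dim (scal V) (weight_space V (of_int n))) \<and>
     (\<exists>N::int. \<forall>n<N. weight_space V (of_int n) = {0})"

definition grading_restricted_generalized_module ::
    "'v::ab_group_add voa \<Rightarrow> ('v, 'w::ab_group_add, 'e) voa_mod_scheme \<Rightarrow> bool" where
  "grading_restricted_generalized_module V M \<longleftrightarrow>
     module_axioms V M \<and>
     module.span (scal M) (\<Union>h. gen_weight_space V M h) = UNIV \<and>
     (\<forall>h. finite_dim (scal M) (gen_weight_space V M h)) \<and>
     (\<forall>h. \<exists>N::int. \<forall>m<N. gen_weight_space V M (h + of_int m) = {0})"

definition submodule ::
    "'v voa \<Rightarrow> ('v, 'w::ab_group_add, 'e) voa_mod_scheme \<Rightarrow> 'w set \<Rightarrow> bool" where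
  "submodule V M S \<longleftrightarrow>
     module.subspace (scal M) S \<and> (\<forall>u n. \<forall>w\<in>S. act M u n w \<in> S)"

definition irreducible_module ::
    "'v voa \<Rightarrow> ('v, 'w::ab_group_add, 'e) voa_mod_scheme \<Rightarrow> bool" where
  "irreducible_module V M \<longleftrightarrow>
     (UNIV :: 'w set) \<noteq> {0} \<and> (\<forall>S. submodule V M S \<longrightarrow> S = {0} \<or> S = UNIV)"

definition voa_ideal :: "'v::ab_group_add voa \<Rightarrow> 'v set \<Rightarrow> bool" where
  "voa_ideal V I \<longleftrightarrow>
     module.subspace (scal V) I \<and> (\<forall>u n. \<forall>v\<in>I. act V u n v \<in> I \<and> act V v n u \<in> I)"

definition simple_voa :: "'v::ab_group_add voa \<Rightarrow> bool" where
  "simple_voa V \<longleftrightarrow>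
     vertex_operator_algebra V \<and> (UNIV :: 'v set) \<noteq> {0} \<and>
     (\<forall>I. voa_ideal V I \<longrightarrow> I = {0} \<or> I = UNIV)"

definition voa_hom :: "'u::ab_group_add voa \<Rightarrow> 'v::ab_group_add voa \<Rightarrow> ('u \<Rightarrow> 'v) \<Rightarrow> bool" where
  "voa_hom V L p \<longleftrightarrow>
     Vector_Spaces.linear (scal V) (scal L) p \<and>
     (\<forall>u n v. p (act V u n v) = act L (p u) n (p v)) \<and>
     p (vac V) = vac L \<and> p (conf V) = conf L"

section \<open>The Lie algebra $sp(2n)$\<close>

text \<open>
  Here $n$ is \<open>CARD('n)\<close>; the coordinates of $\mathbb C^{2n}$ are indexed by two copies of
  \<open>'n\<close>, and the order of \<open>'n\<close> selects the positive roots.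
\<close>

type_synonym 'n mat2 = "complex ^ ('n + 'n) ^ ('n + 'n)"

definition mscale :: "complex \<Rightarrow> 'n::finite mat2 \<Rightarrow> 'n mat2" where
  "mscale c A = (\<chi> i j. c * A $ i $ j)"

definition symplectic_form :: "'n::finite mat2" where
  "symplectic_form = (\<chi> a b. case (a, b) of
      (Inl i, Inr j) \<Rightarrow> if i = j then 1 else 0
    | (Inr i, Inl j) \<Rightarrow> if i = j then - 1 else 0
    | _ \<Rightarrow> 0)"

definition sp :: "'n::finite mat2 set" where
  "sp = {X. transpose X ** symplectic_form + symplectic_form ** X = 0}"

definition bracket :: "'n::finite mat2 \<Rightarrow> 'n mat2 \<Rightarrow> 'n mat2" where
  "bracket X Y = X ** Y - Y ** X"

text \<open>
  The trace form of the defining representation is the invariant form for which the long roots,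
  in particular the highest root, have square length $2$; see \<open>highest_root_normalization\<close> below.
\<close>

definition sp_form :: "'n::finite mat2 \<Rightarrow> 'n mat2 \<Rightarrow> complex" where
  "sp_form X Y = trace (X ** Y)"

definition matrix_unit :: "'n::finite + 'n \<Rightarrow> 'n + 'n \<Rightarrow> 'n mat2" where
  "matrix_unit a b = (\<chi> r s. if r = a \<and> s = b then 1 else 0)"

definition cartan :: "'n::finite mat2 set" where
  "cartan = {H \<in> sp. \<forall>a b. a \<noteq> b \<longrightarrow> H $ a $ b = 0}"

text \<open>
  The positive roots are $\epsilon_i-\epsilon_j$ for $i<j$ and $\epsilon_i+\epsilon_j$ for
  $i\le j$.
\<close>

definition positive_root_vectors :: "'n::{finite,linorder} mat2 set" where
  "positive_root_vectors =
     {matrix_unit (Inl i) (Inl j) - matrix_unit (Inr j) (Inr i) | i j. i < j} \<union>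
     {matrix_unit (Inl i) (Inr j) + matrix_unit (Inl j) (Inr i) | i j. i < j} \<union>
     {matrix_unit (Inl i) (Inr i) | i. True}"

definition dual_coxeter :: "'n::finite itself \<Rightarrow> complex" where
  "dual_coxeter _ = of_nat (CARD('n) + 1)"

lemma vector_space_mscale: "vector_space (mscale :: complex \<Rightarrow> 'n::finite mat2 \<Rightarrow> 'n mat2)"
  by standard (auto simp: mscale_def vec_eq_iff algebra_simps)

lemma matrix_unit_mult:
  "matrix_unit a b ** matrix_unit c d = (if b = c then matrix_unit a d else 0)"
  by (auto simp: matrix_unit_def matrix_matrix_mult_def vec_eq_iff if_distrib[of "\<lambda>x. x * _"]
      sum.delta cong: if_cong)

lemma mat_diffs:
  fixes A B C :: "'n::finite mat2"
  shows "A ** (B - C) = A ** B - A ** C" and "(A - B) ** C = A ** C - B ** C"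
  by (simp_all add: matrix_matrix_mult_def vec_eq_iff algebra_simps sum_subtractf)

text \<open>
  For the highest root (\<open>i\<close> the least index) the element \<open>[e, f]\<close> is the coroot; since its square
  length is $2$, so is that of the root.
\<close>

lemma highest_root_normalization:
  fixes i :: "'n::finite"
  defines "e \<equiv> matrix_unit (Inl i) (Inr i)" and "f \<equiv> matrix_unit (Inr i) (Inl i)"
  shows "bracket (bracket e f) e = mscale 2 e"
    and "bracket (bracket e f) f = mscale (- 2) f"
    and "sp_form (bracket e f) (bracket e f) = 2"
proof -
  have h: "bracket e f = matrix_unit (Inl i) (Inl i) - matrix_unit (Inr i) (Inr i)"
    by (simp add: bracket_def e_def f_def matrix_unit_mult)
  show "bracket (bracket e f) e = mscale 2 e"
    unfolding h by (simp add: bracket_def e_def mat_diffs matrix_unit_mult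
        mscale_def vec_eq_iff)
  show "bracket (bracket e f) f = mscale (- 2) f"
    unfolding h by (simp add: bracket_def f_def mat_diffs matrix_unit_mult
        mscale_def vec_eq_iff)
  have t: "trace (matrix_unit a a :: 'n mat2) = 1" for a
    by (simp add: trace_def matrix_unit_def)
  show "sp_form (bracket e f) (bracket e f) = 2"
    unfolding h by (simp add: sp_form_def mat_diffs matrix_unit_mult
        trace_sub trace_add t)
qed

section \<open>Affine vertex operator algebras of $sp(2n)$\<close>

text \<open>
  A linear map \<open>j\<close> from $sp(2n)$ to a vertex operator algebra \<open>V\<close> lets $x \otimes t^m$ act on a
  \<open>V\<close>-module as the mode $j(x)_m$. The following says that, with the central element acting as
  \<open>k\<close>, this is a representation of the affine Lie algebra.
\<close>

definition affine_relations :: "complex \<Rightarrow> ('v, 'w::ab_group_add, 'e) voa_mod_scheme \<Rightarrow>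
    ('n::finite mat2 \<Rightarrow> 'v) \<Rightarrow> bool" where
  "affine_relations k M j \<longleftrightarrow> (\<forall>x\<in>sp. \<forall>y\<in>sp. \<forall>m p w.
     act M (j x) m (act M (j y) p w) - act M (j y) p (act M (j x) m w)
     = act M (j (bracket x y)) (m + p) w
       + (if m + p = 0 then scal M (of_int m * sp_form x y * k) w else 0))"

text \<open>
  The vacuum module $U(\hat{\mathfrak g}) \otimes_{U(\mathfrak g[t] \oplus \mathbb C K)}
  \mathbb C_k$ is presented as the space of formal linear combinations of words in the letters
  $(x, m) = x \otimes t^m$ (a word stands for a product applied to the vacuum), modulo the
  subspace spanned by \<open>vacuum_relators\<close>: linearity in $x$, the commutation relations with $K$
  replaced by \<open>k\<close>, and the vanishing of the words whose last letter lies in $\mathfrak g[t]$.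
\<close>

type_synonym 'n word_comb = "('n mat2 \<times> int) list \<Rightarrow>\<^sub>0 complex"

definition affine_words :: "('n::finite mat2 \<times> int) list set" where
  "affine_words = lists (sp \<times> UNIV)"

definition wscale :: "complex \<Rightarrow> 'n::finite word_comb \<Rightarrow> 'n word_comb" where
  "wscale c f = Poly_Mapping.map ((*) c) f"

lemma lookup_wscale: "Poly_Mapping.lookup (wscale c f) w = c * Poly_Mapping.lookup f w"
  by (simp add: wscale_def Poly_Mapping.map.rep_eq when_def)

lemma vector_space_wscale:
  "vector_space (wscale :: complex \<Rightarrow> 'n::finite word_comb \<Rightarrow> 'n word_comb)"
  by standard (auto intro!: poly_mapping_eqI simp: lookup_wscale lookup_add algebra_simps)

definition word :: "('n::finite mat2 \<times> int) list \<Rightarrow> 'n word_comb" where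
  "word w = Poly_Mapping.single w 1"

definition vacuum_relators :: "complex \<Rightarrow> 'n::finite word_comb set" where
  "vacuum_relators k =
     {word (u @ [(x + y, m)] @ w) - word (u @ [(x, m)] @ w) - word (u @ [(y, m)] @ w)
       | u w x y m. u \<in> affine_words \<and> w \<in> affine_words \<and> x \<in> sp \<and> y \<in> sp} \<union>
     {word (u @ [(mscale c x, m)] @ w) - wscale c (word (u @ [(x, m)] @ w))
       | u w c x m. u \<in> affine_words \<and> w \<in> affine_words \<and> x \<in> sp} \<union>
     {word (u @ [(x, m), (y, p)] @ w) - word (u @ [(y, p), (x, m)] @ w)
        - word (u @ [(bracket x y, m + p)] @ w)
        - (if m + p = 0 then wscale (of_int m * sp_form x y * k) (word (u @ w)) else 0)
       | u w x y m p. u \<in> affine_words \<and> w \<in> affine_words \<and> x \<in> sp \<and> y \<in> sp} \<union>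
     {word (u @ [(x, m)]) | u x m. u \<in> affine_words \<and> x \<in> sp \<and> m \<ge> 0}"

definition apply_word ::
    "'v voa \<Rightarrow> ('n::finite mat2 \<Rightarrow> 'v) \<Rightarrow> ('n mat2 \<times> int) list \<Rightarrow> 'v" where
  "apply_word V j w = foldr (\<lambda>(x, m) v. act V (j x) m v) w (vac V)"

definition apply_comb ::
    "'v::ab_group_add voa \<Rightarrow> ('n::finite mat2 \<Rightarrow> 'v) \<Rightarrow> 'n word_comb \<Rightarrow> 'v" where
  "apply_comb V j f =
     (\<Sum>w\<in>Poly_Mapping.keys f. scal V (Poly_Mapping.lookup f w) (apply_word V j w))"

definition is_vacuum_module ::
    "complex \<Rightarrow> 'v::ab_group_add voa \<Rightarrow> ('n::finite mat2 \<Rightarrow> 'v) \<Rightarrow> bool" where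
  "is_vacuum_module k V j \<longleftrightarrow>
     (\<forall>v. \<exists>f. Poly_Mapping.keys f \<subseteq> affine_words \<and> apply_comb V j f = v) \<and>
     {f. Poly_Mapping.keys f \<subseteq> affine_words \<and> apply_comb V j f = 0}
       = module.span wscale (vacuum_relators k)"

definition sugawara_vector ::
    "complex \<Rightarrow> 'v::ab_group_add voa \<Rightarrow> ('n::finite mat2 \<Rightarrow> 'v) \<Rightarrow> 'v \<Rightarrow> bool" where
  "sugawara_vector k V j om \<longleftrightarrow>
     (\<exists>(B :: 'n mat2 set) d. finite B \<and> B \<subseteq> sp \<and> sp \<subseteq> module.span mscale B \<and>
        d ` B \<subseteq> sp \<and> (\<forall>b\<in>B. \<forall>c\<in>B. sp_form b (d c) = (if b = c then 1 else 0)) \<and>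
        om = scal V (1 / (2 * (k + dual_coxeter TYPE('n))))
               (\<Sum>b\<in>B. act V (j b) (- 1) (act V (j (d b)) (- 1) (vac V))))"

text \<open>
  \<open>V\<close>, with \<open>j\<close> sending $x$ to $x(-1)\mathbf 1$, is the universal affine vertex operator algebra
  $V^k(sp(2n))$: the vacuum module with $Y(x(-1)\mathbf 1, z) = \sum_m x(m) z^{-m-1}$
  and the Sugawara conformal vector. Since the \<open>j x\<close> generate \<open>V\<close>, this determines the triple
  of \<open>V\<close>, its vertex operators and its conformal vector up to isomorphism.
\<close>

definition universal_affine_voa ::
    "complex \<Rightarrow> 'v::ab_group_add voa \<Rightarrow> ('n::finite mat2 \<Rightarrow> 'v) \<Rightarrow> bool" where
  "universal_affine_voa k V j \<longleftrightarrow>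
     k \<noteq> - dual_coxeter TYPE('n) \<and>
     vertex_operator_algebra V \<and>
     (\<forall>x\<in>sp. \<forall>y\<in>sp. j (x + y) = j x + j y) \<and>
     (\<forall>c. \<forall>x\<in>sp. j (mscale c x) = scal V c (j x)) \<and>
     (\<forall>x\<in>sp. j x \<in> weight_space V 1) \<and>
     affine_relations k V j \<and>
     is_vacuum_module k V j \<and>
     sugawara_vector k V j (conf V)"

text \<open>
  \<open>L\<close> is $L_k(sp(2n))$, the simple quotient of $V^k(sp(2n))$, with \<open>p\<close> the quotient map.
\<close>

definition simple_affine_voa :: "complex \<Rightarrow> 'u::ab_group_add voa \<Rightarrow> ('n::finite mat2 \<Rightarrow> 'u) \<Rightarrow>
    'v::ab_group_add voa \<Rightarrow> ('u \<Rightarrow> 'v) \<Rightarrow> bool" where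
  "simple_affine_voa k V j L p \<longleftrightarrow>
     universal_affine_voa k V j \<and> simple_voa L \<and> voa_hom V L p \<and> surj p"

text \<open>
  Below \<open>wt\<close> is the $\mathfrak g$-weight of the generating vector, as a function on the Cartan
  subalgebra; the highest weight $k\Lambda_0$ is \<open>wt = (\<lambda>_. 0)\<close> at level \<open>k\<close>.
\<close>

definition highest_weight_vector :: "complex \<Rightarrow> ('v, 'w::ab_group_add, 'e) voa_mod_scheme \<Rightarrow>
    ('n::{finite,linorder} mat2 \<Rightarrow> 'v) \<Rightarrow> ('n mat2 \<Rightarrow> complex) \<Rightarrow> 'w \<Rightarrow> bool" where
  "highest_weight_vector k M j wt w \<longleftrightarrow>
     w \<noteq> 0 \<and>
     affine_relations k M j \<and>
     (\<forall>x\<in>sp. \<forall>m>0. act M (j x) m w = 0) \<and>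
     (\<forall>x\<in>positive_root_vectors. act M (j x) 0 w = 0) \<and>
     (\<forall>h\<in>cartan. act M (j h) 0 w = scal M (wt h) w)"

definition highest_weight_module :: "complex \<Rightarrow> 'v voa \<Rightarrow>
    ('v, 'w::ab_group_add, 'e) voa_mod_scheme \<Rightarrow>
    ('n::{finite,linorder} mat2 \<Rightarrow> 'v) \<Rightarrow> ('n mat2 \<Rightarrow> complex) \<Rightarrow> bool" where
  "highest_weight_module k V M j wt \<longleftrightarrow>
     (\<exists>w. highest_weight_vector k M j wt w \<and> (\<forall>S. submodule V M S \<and> w \<in> S \<longrightarrow> S = UNIV))"

end

theory Submission
  imports Defs
begin

text \<open>
  Since $M$ has finite-dimensional generalized $L(0)$-eigenspaces, the $sl_2$-triple of each
  positive root shows that the generating vector $w$, of weight $0$, is killed by the whole of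
  $sp(2n)$, hence by $sp(2n)\otimes\mathbb C[t]$. As $L$ is generated by $sp(2n)$, it follows that
  $u_n w = 0$ for all $u \in L$ and $n \ge 0$, so that $u \mapsto u_{-1} w$ is a homomorphism of
  $L$-modules from $L$ onto $M$. By skew symmetry a submodule of $L$ is an ideal, so $L$ is
  irreducible as a module over itself, and so is its nonzero quotient $M$.
\<close>

section \<open>A consequence of $sl_2$-theory\<close>

context vector_space
begin

lemma linear_funpow:
  assumes "Vector_Spaces.linear scale scale T"
  shows "Vector_Spaces.linear scale scale (T ^^ k)"
proof (induction k)
  case 0
  show ?case using linear_id by (simp add: id_def)
next
  case (Suc k)
  show ?case using Vector_Spaces.linear_compose[OF Suc assms] by (simp add: o_def)
qed

text \<open>\<open>f w\<close> is again killed by \<open>e\<close> and has weight -2. Were it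
  nonzero, it would generate an infinite-dimensional Verma module, whereas \<open>B\<close> confines
  the orbit of \<open>w\<close> to a finite-dimensional space. The scalars form an arbitrary field,
  hence \<open>char0\<close>.\<close>

lemma sl2_weight_zero_lowering_trivial:
  assumes e: "Vector_Spaces.linear scale scale e"
    and h: "Vector_Spaces.linear scale scale h"
    and f: "Vector_Spaces.linear scale scale f"
    and ef: "\<And>x. e (f x) = f (e x) + h x"
    and hf: "\<And>x. h (f x) = f (h x) - scale 2 (f x)"
    and w: "e w = 0" "h w = 0"
    and B: "finite B" "\<And>k. (f ^^ k) w \<in> span B"
    and char0: "\<And>k::nat. k > 0 \<Longrightarrow> of_nat k \<noteq> (0::'a)"
  shows "f w = 0"
proof (rule ccontr)
  assume nz: "f w \<noteq> 0"
  interpret e: Vector_Spaces.linear scale scale e by fact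
  interpret h: Vector_Spaces.linear scale scale h by fact
  interpret f: Vector_Spaces.linear scale scale f by fact
  define v where "v k = (f ^^ k) w" for k
  have v_Suc: "v (Suc k) = f (v k)" for k by (simp add: v_def)
  have hv: "h (v k) = scale (- (2 * of_nat k)) (v k)" for k
  proof (induction k)
    case 0 show ?case by (simp add: v_def w)
  next
    case (Suc k)
    then show ?case
      by (simp add: v_Suc hf f.scale algebra_simps flip: scale_left_distrib scale_minus_left)
  qed
  \<comment> \<open>The usual coefficient \<open>(k + 1) * (\<lambda> - k)\<close> for highest
    weight \<lambda>, taken at \<lambda> = 0; in characteristic 0 it vanishes only for
    \<open>k = 0\<close>.\<close>
  have ev: "e (v (Suc k)) = scale (- of_nat (Suc k * k)) (v k)" for k
  proof (induction k)
    case 0 show ?case by (simp add: v_def w ef)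
  next
    case (Suc k)
    have "e (v (Suc (Suc k))) = f (e (v (Suc k))) + h (v (Suc k))"
      by (simp add: v_Suc ef)
    also have "\<dots> = scale (- of_nat (Suc k * k) - 2 * of_nat (Suc k)) (v (Suc k))"
      unfolding Suc hv by (simp add: f.scale v_Suc flip: scale_left_distrib)
    also have "- of_nat (Suc k * k) - 2 * of_nat (Suc k) = (- of_nat (Suc (Suc k) * Suc k) :: 'a)"
      by (simp add: algebra_simps)
    finally show ?case .
  qed
  have ek: "Vector_Spaces.linear scale scale (e ^^ k)" for k
    using linear_funpow[OF e] .
  have pow: "(e ^^ Suc k) (v (Suc (Suc k))) = scale (- of_nat (Suc (Suc k) * Suc k)) ((e ^^ k) (v (Suc k)))"
    for k
    by (simp only: funpow_Suc_right o_apply ev module_hom.scale[OF module_hom_linearI[OF ek]])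
  \<comment> \<open>Raising \<open>k\<close> times leads back to a multiple of \<open>f w\<close>
    whose factors \<open>- (i + 1) * i\<close> with \<open>1 \<le> i \<le> k\<close> are all
    nonzero.\<close>
  have top: "(e ^^ k) (v (Suc k)) \<noteq> 0" for k
  proof (induction k)
    case 0 show ?case using nz by (simp add: v_def)
  next
    case (Suc k)
    then show ?case unfolding pow using char0[of "Suc (Suc k) * Suc k"] by (simp del: of_nat_mult of_nat_Suc of_nat_add)
  qed
  \<comment> \<open>One more raising step kills \<open>f w\<close>; \<open>d\<close> covers all
    higher powers.\<close>
  have low: "(e ^^ Suc (k + d)) (v (Suc k)) = 0" for k d
  proof (induction k)
    case 0
    have "e (v (Suc 0)) = 0" by (simp add: ev)
    then show ?case
      by (simp only: funpow_Suc_right o_apply module_hom.zero[OF module_hom_linearI[OF ek]])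
  next
    case (Suc k)
    have "(e ^^ Suc (Suc (k + d))) (v (Suc (Suc k)))
      = scale (- of_nat (Suc (Suc k) * Suc k)) ((e ^^ Suc (k + d)) (v (Suc k)))"
      by (simp only: funpow_Suc_right[of "Suc (k + d)"] o_apply ev
          module_hom.scale[OF module_hom_linearI[OF ek]])
    then show ?case using Suc by simp
  qed
  \<comment> \<open>The power \<open>e ^^ k\<close> separates: it kills the earlier vectors but not
    this one.\<close>
  have notin: "v (Suc k) \<notin> span ((\<lambda>i. v (Suc i)) ` {..<k})" for k
  proof
    assume "v (Suc k) \<in> span ((\<lambda>i. v (Suc i)) ` {..<k})"
    then have "(e ^^ k) (v (Suc k)) = 0"
    proof (rule module_hom.eq_0_on_span[OF module_hom_linearI[OF ek], rotated])
      fix x assume "x \<in> (\<lambda>i. v (Suc i)) ` {..<k}"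
      then obtain i where "i < k" "x = v (Suc i)" by auto
      then show "(e ^^ k) x = 0" using low[of i "k - Suc i"] by simp
    qed
    then show False using top by blast
  qed
  \<comment> \<open>The cardinality is carried along to exclude repetitions among the vectors, so
    that it can be compared with \<open>card B\<close>.\<close>
  have indep: "independent ((\<lambda>i. v (Suc i)) ` {..<k}) \<and> card ((\<lambda>i. v (Suc i)) ` {..<k}) = k" for k
  proof (induction k)
    case 0 show ?case by (simp add: independent_empty)
  next
    case (Suc k)
    then show ?case
      using notin[of k] span_base[of "v (Suc k)" "(\<lambda>i. v (Suc i)) ` {..<k}"]
      by (auto simp: lessThan_Suc independent_insert card_insert_if)
  qed
  have "(\<lambda>i. v (Suc i)) ` {..<Suc (card B)} \<subseteq> span B"
    using B(2) by (auto simp: v_def simp del: funpow.simps)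
  then have "Suc (card B) \<le> card B"
    using independent_span_bound[OF B(1)] indep[of "Suc (card B)"] by metis
  then show False by simp
qed

end

section \<open>Modules of vertex operator algebras\<close>

lemma Sum_any_only_0:
  fixes g :: "nat \<Rightarrow> 'a::comm_monoid_add"
  assumes "\<And>i. i > 0 \<Longrightarrow> g i = 0"
  shows "Sum_any g = g 0"
proof -
  have "{i. g i \<noteq> 0} \<subseteq> {0}" using assms by (auto intro: ccontr)
  then show ?thesis using Sum_any.expand_superset[of "{0}" g] by simp
qed

lemma zero_gchoose: "i > 0 \<Longrightarrow> (0::'a::field_char_0) gchoose i = 0"
  by (cases i) simp_all

text \<open>Infinite support is harmless: \<open>Sum_any g\<close> is then 0, which lies in
  \<open>S\<close>.\<close>

lemma Sum_any_mem_subspace: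
  assumes "vector_space s" "module.subspace s S" "\<And>i. g i \<in> S"
  shows "Sum_any g \<in> S"
proof -
  interpret vector_space s by fact
  show ?thesis unfolding Sum_any.expand_set using assms(2,3) by (intro subspace_sum)
qed

locale voa_module =
  fixes V :: "'v::ab_group_add voa" and M :: "('v, 'w::ab_group_add, 'e) voa_mod_scheme"
  assumes vector_space_V: "vector_space (scal V)"
    and axioms: "module_axioms V M"
begin

sublocale V: vector_space "scal V" by (rule vector_space_V)

sublocale M: vector_space "scal M" using axioms by (simp add: module_axioms_def)

lemma linear_act: "Vector_Spaces.linear (scal M) (scal M) (act M u n)"
  using axioms by (simp add: module_axioms_def)

lemma linear_act_left: "Vector_Spaces.linear (scal V) (scal M) (\<lambda>u. act M u n w)"
  using axioms by (simp add: module_axioms_def)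

sublocale act: Vector_Spaces.linear "scal M" "scal M" "act M u n" for u n
  by (rule linear_act)

sublocale act_left: Vector_Spaces.linear "scal V" "scal M" "\<lambda>u. act M u n w" for n w
  by (rule linear_act_left)

lemma act_vac: "act M (vac V) n w = (if n = - 1 then w else 0)"
  using axioms by (simp add: module_axioms_def)

lemma jacobi:
  "Sum_any (\<lambda>i::nat. scal M ((- 1) ^ i * (of_int l gchoose i))
       (act M u (m + l - int i) (act M v (n + int i) w)
        - scal M ((- 1) powi l) (act M v (n + l - int i) (act M u (m + int i) w))))
     = Sum_any (\<lambda>i::nat. scal M (of_int m gchoose i)
         (act M (act V u (l + int i) v) (m + n - int i) w))"
  using axioms by (simp add: module_axioms_def jacobi_identity_def)

lemma derivative:
  "act M (virasoro_mode V V (- 1) u) n w = scal M (- of_int n) (act M u (n - 1) w)"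
  using axioms by (simp add: module_axioms_def)

text \<open>The case \<open>m = 0\<close> of the Jacobi identity, where \<open>0 gchoose i\<close>
  leaves one term on the right.\<close>

lemma iterate:
  "act M (act V u l v) n w =
     Sum_any (\<lambda>i::nat. scal M ((- 1) ^ i * (of_int l gchoose i))
       (act M u (l - int i) (act M v (n + int i) w)
        - scal M ((- 1) powi l) (act M v (n + l - int i) (act M u (int i) w))))"
proof -
  have "Sum_any (\<lambda>i::nat. scal M (of_int 0 gchoose i)
         (act M (act V u (l + int i) v) (0 + n - int i) w)) = act M (act V u l v) n w"
    by (subst Sum_any_only_0) (simp_all add: zero_gchoose)
  then show ?thesis using jacobi[of l u 0 v n w] by simp
qed

text \<open>The case \<open>l = 0\<close>, where it is the left side that collapses.\<close>

lemma commutator: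
  "act M u m (act M v n w) - act M v n (act M u m w) =
     Sum_any (\<lambda>i::nat. scal M (of_int m gchoose i) (act M (act V u (int i) v) (m + n - int i) w))"
proof -
  have "Sum_any (\<lambda>i::nat. scal M ((- 1) ^ i * (of_int 0 gchoose i))
       (act M u (m + 0 - int i) (act M v (n + int i) w)
        - scal M ((- 1) powi 0) (act M v (n + 0 - int i) (act M u (m + int i) w))))
      = act M u m (act M v n w) - act M v n (act M u m w)"
    by (subst Sum_any_only_0) (simp_all add: zero_gchoose)
  then show ?thesis using jacobi[of 0 u m v n w] by simp
qed

section \<open>Zero modes of vectors of weight one\<close>

lemma L0_commutes_zero_mode:
  assumes "a \<in> weight_space V 1"
  shows "virasoro_mode V M 0 (act M a 0 x) = act M a 0 (virasoro_mode V M 0 x)"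
proof -
  \<comment> \<open>L(0) is the mode \<open>1\<close> of \<open>conf V\<close>, so only
    \<open>i = 0\<close> and \<open>i = 1\<close> contribute. They give
    \<open>(L(-1) a)_1 = - a_0\<close> and \<open>(L(0) a)_0 = a_0\<close>, which cancel.\<close>
  let ?g = "\<lambda>i::nat. scal M (of_int 1 gchoose i) (act M (act V (conf V) (int i) a) (1 + 0 - int i) x)"
  have "{i. ?g i \<noteq> 0} \<subseteq> {0, 1}"
  proof (rule subsetI, rule ccontr)
    fix i assume "i \<in> {i. ?g i \<noteq> 0}" "i \<notin> {0, 1}"
    then have "?g i \<noteq> 0" "i \<notin> {0, 1}" by simp_all
    then have "(of_int 1 :: complex) gchoose i = 0"
      using binomial_gbinomial[of 1 i, where ?'a = complex] by (simp add: binomial_eq_0)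
    with \<open>?g i \<noteq> 0\<close> show False by simp
  qed
  then have "Sum_any ?g = ?g 0 + ?g 1"
    using Sum_any.expand_superset[of "{0, 1}" ?g] by simp
  also have "\<dots> = act M (virasoro_mode V V (- 1) a) 1 x + act M (virasoro_mode V V 0 a) 0 x"
    by (simp add: virasoro_mode_def)
  also have "\<dots> = 0"
    using assms by (simp add: derivative weight_space_def act_left.scale)
  finally show ?thesis
    using commutator[of "conf V" 1 a 0 x] by (simp add: virasoro_mode_def)
qed

lemma zero_mode_preserves_gen_weight_space:
  assumes "a \<in> weight_space V 1" "x \<in> gen_weight_space V M h"
  shows "act M a 0 x \<in> gen_weight_space V M h"
proof -
  let ?D = "\<lambda>x. virasoro_mode V M 0 x - scal M h x"
  have 1: "?D (act M a 0 y) = act M a 0 (?D y)" for y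
    by (simp add: L0_commutes_zero_mode[OF assms(1)] act.diff act.scale)
  have "(?D ^^ N) (act M a 0 y) = act M a 0 ((?D ^^ N) y)" for N y
    by (induction N) (simp_all add: 1)
  moreover obtain N where "(?D ^^ N) x = 0" using assms(2) by (auto simp: gen_weight_space_def)
  ultimately have "(?D ^^ N) (act M a 0 x) = 0" by (simp add: act.zero)
  then show ?thesis by (auto simp: gen_weight_space_def)
qed

text \<open>Vectors with a finite-dimensional orbit span form a subspace. It contains each
  generalized weight space, which is finite-dimensional and stable under the zero mode, and these
  spaces span. This supplies \<open>B\<close> for the sl2 argument.\<close>

lemma zero_mode_locally_finite:
  assumes gr: "grading_restricted_generalized_module V M" and a: "a \<in> weight_space V 1"
  shows "\<exists>B. finite B \<and> (\<forall>k. (act M a 0 ^^ k) x \<in> M.span B)"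
proof -
  let ?T = "act M a 0"
  let ?P = "{x. \<exists>B. finite B \<and> (\<forall>k. (?T ^^ k) x \<in> M.span B)}"
  have T: "module_hom (scal M) (scal M) (?T ^^ k)" for k
    using M.linear_funpow[OF linear_act] by (rule module_hom_linearI)
  have PI: "x \<in> ?P" if "finite B" "\<And>k. (?T ^^ k) x \<in> M.span B" for x B
    using that by blast
  have "M.subspace ?P"
  proof (rule M.subspaceI)
    show "0 \<in> ?P"
      by (rule PI[of "{}"]) (simp_all add: module_hom.zero[OF T])
  next
    fix x y assume "x \<in> ?P" "y \<in> ?P"
    then obtain B C where B: "finite B" "\<And>k. (?T ^^ k) x \<in> M.span B"
      and C: "finite C" "\<And>k. (?T ^^ k) y \<in> M.span C" by blast
    show "x + y \<in> ?P"
    proof (rule PI[of "B \<union> C"])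
      show "(?T ^^ k) (x + y) \<in> M.span (B \<union> C)" for k
        unfolding module_hom.add[OF T]
        using B(2)[of k] C(2)[of k] M.span_mono[of B "B \<union> C"] M.span_mono[of C "B \<union> C"]
        by (intro M.span_add) blast+
    qed (use B C in simp)
  next
    fix c x assume "x \<in> ?P"
    then obtain B where B: "finite B" "\<And>k. (?T ^^ k) x \<in> M.span B" by blast
    show "scal M c x \<in> ?P"
      by (rule PI[of B]) (use B in \<open>simp_all add: module_hom.scale[OF T] M.span_scale\<close>)
  qed
  moreover have "gen_weight_space V M h \<subseteq> ?P" for h
  proof
    fix x assume x: "x \<in> gen_weight_space V M h"
    have pow: "(?T ^^ k) x \<in> gen_weight_space V M h" for k
      by (induction k) (simp_all add: x zero_mode_preserves_gen_weight_space[OF a])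
    have "finite_dim (scal M) (gen_weight_space V M h)"
      using gr by (simp add: grading_restricted_generalized_module_def)
    then obtain B where "finite B" "gen_weight_space V M h \<subseteq> M.span B"
      unfolding finite_dim_def by (elim exE conjE)
    with pow show "x \<in> ?P" by (intro PI[of B]) auto
  qed
  ultimately have "M.span (\<Union>h. gen_weight_space V M h) \<subseteq> ?P"
    by (intro M.span_minimal) auto
  then show ?thesis using gr by (auto simp: grading_restricted_generalized_module_def)
qed

section \<open>Vacuum-like vectors\<close>

definition vacuum_like :: "'w \<Rightarrow> bool" where
  "vacuum_like w \<longleftrightarrow> (\<forall>u. \<forall>n\<ge>0. act M u n w = 0)"

text \<open>In \<open>iterate\<close> with \<open>n \<ge> 0\<close>, each term applies to
  \<open>w\<close> first either the mode \<open>n + i\<close> of \<open>u\<close> or the mode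
  \<open>i\<close> of \<open>a\<close>. This is the induction step from generators to words.\<close>

lemma act_iterate_vanishing:
  assumes "\<And>n. n \<ge> 0 \<Longrightarrow> act M a n w = 0" "\<And>n. n \<ge> 0 \<Longrightarrow> act M u n w = 0" "n \<ge> 0"
  shows "act M (act V a l u) n w = 0"
  using assms by (simp add: iterate act.zero)

text \<open>In \<open>iterate\<close> at \<open>n = - 1\<close>, the terms starting with a mode
  \<open>i\<close> of \<open>a\<close> vanish, and \<open>u\<close> contributes only its mode
  \<open>- 1\<close>, at \<open>i = 0\<close>.\<close>

lemma vacuum_like_hom:
  assumes "vacuum_like w"
  shows "act M (act V a l u) (- 1) w = act M a l (act M u (- 1) w)"
  using assms unfolding iterate
  by (subst Sum_any_only_0) (simp_all add: vacuum_like_def act.zero)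

end

section \<open>Simple vertex operator algebras are irreducible modules\<close>

text \<open>A submodule is closed under \<open>u_n\<close> by definition; the other half, that
  \<open>s_l u\<close> stays in \<open>S\<close> for \<open>s\<close> in \<open>S\<close>, is skew
  symmetry.\<close>

lemma voa_submodule_ideal:
  fixes L :: "'v::ab_group_add voa"
  assumes L: "vertex_operator_algebra L" and S: "submodule L L S"
  shows "voa_ideal L S"
proof -
  have ax: "module_axioms L L" using L by (simp add: vertex_operator_algebra_def)
  interpret voa_module L L
    by unfold_locales (use ax in \<open>auto simp: module_axioms_def vector_space_def\<close>)
  have create: "act L v (- 1) (vac L) = v" and vanish: "n \<ge> 0 \<Longrightarrow> act L v n (vac L) = 0" for v n
    using L by (auto simp: vertex_operator_algebra_def)
  have sub: "V.subspace S" and act_S: "\<And>u n x. x \<in> S \<Longrightarrow> act L u n x \<in> S"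
    using S by (auto simp: submodule_def)
  \<comment> \<open>This vector is \<open>L(-1)^i s / i!\<close>, and \<open>S\<close> is stable
    under L(-1), a mode of \<open>conf L\<close>; each step divides by \<open>i + 1\<close>.\<close>
  have desc: "act L s (- 1 - int i) (vac L) \<in> S" if "s \<in> S" for s i
    using that
  proof (induction i arbitrary: s)
    case 0 then show ?case by (simp add: create)
  next
    case (Suc i)
    let ?c = "of_nat (Suc i) :: complex"
    have "act L (virasoro_mode L L (- 1) s) (- 1 - int i) (vac L)
        = scal L ?c (act L s (- 1 - int (Suc i)) (vac L))"
      unfolding derivative by (simp add: algebra_simps)
    moreover have "virasoro_mode L L (- 1) s \<in> S"
      using Suc.prems act_S by (simp add: virasoro_mode_def)
    ultimately have "scal L ?c (act L s (- 1 - int (Suc i)) (vac L)) \<in> S"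
      using Suc.IH by metis
    then have "scal L (1 / ?c) (scal L ?c (act L s (- 1 - int (Suc i)) (vac L))) \<in> S"
      by (rule V.subspace_scale[OF sub])
    then show ?case by (simp del: of_nat_Suc)
  qed
  have "act L s l u \<in> S" if s: "s \<in> S" for s l u
  proof -
    let ?g = "\<lambda>i::nat. scal L ((- 1) ^ i * (of_int l gchoose i))
       (act L u (- 1 + l - int i) (act L s (0 + int i) (vac L))
        - scal L ((- 1) powi l) (act L s (0 + l - int i) (act L u (- 1 + int i) (vac L))))"
    \<comment> \<open>The Jacobi identity on the vacuum vector is skew symmetry; the powers of \<open>L(-1)\<close> in the
      usual formula appear as the modes \<open>s\<^bsub>-1-i\<^esub> 1\<close>.\<close>
    have "Sum_any ?g \<in> S" unfolding jacobi
      using desc[OF act_S[OF s]]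
      by (intro Sum_any_mem_subspace[OF V.vector_space_axioms sub] V.subspace_scale[OF sub])
        simp
    \<comment> \<open>Creation kills every \<open>s_i 1\<close>, and \<open>u_{-1+i} 1\<close> is
      \<open>u\<close> for \<open>i = 0\<close> and zero otherwise.\<close>
    moreover have "Sum_any ?g = - scal L ((- 1) powi l) (act L s l u)"
      by (subst Sum_any_only_0) (simp_all add: vanish create act.zero)
    ultimately have "- scal L ((- 1) powi l) (act L s l u) \<in> S" by simp
    then have "scal L (- inverse ((- 1) powi l)) (- scal L ((- 1) powi l) (act L s l u)) \<in> S"
      by (rule V.subspace_scale[OF sub])
    then show ?thesis by simp
  qed
  then show ?thesis using sub act_S by (simp add: voa_ideal_def)
qed

text \<open>Submodules of \<open>M\<close> pull back along \<open>u_{-1} w\<close> to submodules of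
  \<open>L\<close>, hence to ideals, and surjectivity recovers each from its preimage.\<close>

lemma irreducible_if_generated_by_vacuum_like:
  fixes L :: "'v::ab_group_add voa" and M :: "('v, 'w::ab_group_add, 'e) voa_mod_scheme"
  assumes L: "simple_voa L" and M: "module_axioms L M"
    and w: "w \<noteq> 0" "\<And>u n. n \<ge> 0 \<Longrightarrow> act M u n w = 0"
    and gen: "\<And>S. submodule L M S \<Longrightarrow> w \<in> S \<Longrightarrow> S = UNIV"
  shows "irreducible_module L M"
proof -
  have voa: "vertex_operator_algebra L" using L by (simp add: simple_voa_def)
  have "vector_space (scal L)"
    using voa by (auto simp: vertex_operator_algebra_def module_axioms_def)
  with M interpret voa_module L M by unfold_locales (auto simp: vector_space_def)
  define \<phi> where "\<phi> u = act M u (- 1) w" for u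
  have hom: "\<phi> (act L a l u) = act M a l (\<phi> u)" for a l u
    unfolding \<phi>_def by (rule vacuum_like_hom) (simp add: vacuum_like_def w)
  have \<phi>: "module_hom (scal L) (scal M) \<phi>"
    unfolding \<phi>_def using linear_act_left by (rule module_hom_linearI)
  have "submodule L M (range \<phi>)"
    using module_hom.subspace_image[OF \<phi> V.subspace_UNIV] hom
    by (auto simp: submodule_def simp flip: hom)
  moreover have "w \<in> range \<phi>"
    by (rule range_eqI[of _ _ "vac L"]) (simp add: \<phi>_def act_vac)
  ultimately have surj: "range \<phi> = UNIV" by (rule gen)
  have "S = {0} \<or> S = UNIV" if S: "submodule L M S" for S
  proof -
    have "submodule L L (\<phi> -` S)"
      using S module_hom.subspace_vimage[OF \<phi>, of S] by (auto simp: submodule_def hom)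
    then have "voa_ideal L (\<phi> -` S)" by (rule voa_submodule_ideal[OF voa])
    then have "\<phi> -` S = {0} \<or> \<phi> -` S = UNIV" using L by (simp add: simple_voa_def)
    moreover have "S = \<phi> ` (\<phi> -` S)" using surj by (simp add: surj_image_vimage_eq)
    ultimately have "S = \<phi> ` {0} \<or> S = range \<phi>" by metis
    then show ?thesis by (simp add: surj module_hom.zero[OF \<phi>])
  qed
  then show ?thesis using w(1) by (auto simp: irreducible_module_def)
qed

section \<open>Generators of $sp(2n)$\<close>

text \<open>For \<open>i \<noteq> j\<close> these three families are the short root vectors. On the
  diagonal, \<open>gl_vec i i\<close> is the coroot of a long root, while
  \<open>upper_vec i i\<close> and \<open>lower_vec i i\<close> are twice the long root
  vectors.\<close>

abbreviation gl_vec :: "'n::finite \<Rightarrow> 'n \<Rightarrow> 'n mat2" where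
  "gl_vec i j \<equiv> matrix_unit (Inl i) (Inl j) - matrix_unit (Inr j) (Inr i)"

abbreviation upper_vec :: "'n::finite \<Rightarrow> 'n \<Rightarrow> 'n mat2" where
  "upper_vec i j \<equiv> matrix_unit (Inl i) (Inr j) + matrix_unit (Inl j) (Inr i)"

abbreviation lower_vec :: "'n::finite \<Rightarrow> 'n \<Rightarrow> 'n mat2" where
  "lower_vec i j \<equiv> matrix_unit (Inr i) (Inl j) + matrix_unit (Inr j) (Inl i)"

lemma sum_UNIV_Plus:
  "(\<Sum>c\<in>UNIV. g c) = (\<Sum>i\<in>UNIV. g (Inl i)) + (\<Sum>i\<in>UNIV. g (Inr i))"
  for g :: "'a::finite + 'b::finite \<Rightarrow> 'c::comm_monoid_add"
  by (subst UNIV_Plus_UNIV[symmetric], subst sum.Plus) auto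

text \<open>In n-by-n blocks: the lower right block is minus the transpose of the upper left one,
  and the off-diagonal blocks are symmetric.\<close>

lemma sp_iff:
  "X \<in> sp \<longleftrightarrow> (\<forall>i k. X $ Inr i $ Inr k = - (X $ Inl k $ Inl i) \<and>
     X $ Inl i $ Inr k = X $ Inl k $ Inr i \<and> X $ Inr i $ Inl k = X $ Inr k $ Inl i)"
proof -
  have entry: "(transpose X ** symplectic_form + symplectic_form ** X) $ a $ b =
      (case b of Inl k \<Rightarrow> - (X $ Inr k $ a) | Inr k \<Rightarrow> X $ Inl k $ a) +
      (case a of Inl i \<Rightarrow> X $ Inr i $ b | Inr i \<Rightarrow> - (X $ Inl i $ b))" for a b
    by (cases a; cases b)
      (simp_all add: matrix_matrix_mult_def transpose_def symplectic_form_def sum_UNIV_Plus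
        if_distrib[of "\<lambda>x. x * _"] if_distrib[of "\<lambda>x. _ * x"] sum.delta sum.delta' cong: if_cong)
  have mem: "X \<in> sp \<longleftrightarrow> (\<forall>a b.
      (case b of Inl k \<Rightarrow> - (X $ Inr k $ a) | Inr k \<Rightarrow> X $ Inl k $ a) +
      (case a of Inl i \<Rightarrow> X $ Inr i $ b | Inr i \<Rightarrow> - (X $ Inl i $ b)) = 0)"
    (is "_ \<longleftrightarrow> (\<forall>a b. ?E a b = 0)")
    unfolding sp_def mem_Collect_eq vec_eq_iff entry zero_index ..
  show ?thesis unfolding mem
  proof (intro iffI allI conjI)
    fix i k
    assume E: "\<forall>a b. ?E a b = 0"
    show "X $ Inr i $ Inr k = - (X $ Inl k $ Inl i)"
      using E[rule_format, of "Inl i" "Inr k"] by (simp add: add_eq_0_iff)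
    show "X $ Inl i $ Inr k = X $ Inl k $ Inr i"
      using E[rule_format, of "Inr k" "Inr i"] by simp
    show "X $ Inr i $ Inl k = X $ Inr k $ Inl i"
      using E[rule_format, of "Inl i" "Inl k"] by simp
  next
    fix a b
    assume "\<forall>i k. X $ Inr i $ Inr k = - (X $ Inl k $ Inl i) \<and>
      X $ Inl i $ Inr k = X $ Inl k $ Inr i \<and> X $ Inr i $ Inl k = X $ Inr k $ Inl i"
    then have E: "X $ Inr i $ Inr k = - (X $ Inl k $ Inl i)"
      "X $ Inl i $ Inr k = X $ Inl k $ Inr i" "X $ Inr i $ Inl k = X $ Inr k $ Inl i" for i k
      by blast+
    show "?E a b = 0"
    proof (cases a; cases b)
      fix i k assume "a = Inl i" "b = Inl k"
      then show ?thesis using E(3)[of i k] by simp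
    next
      fix i k assume "a = Inl i" "b = Inr k"
      then show ?thesis using E(1)[of i k] by simp
    next
      fix i k assume "a = Inr i" "b = Inl k"
      then show ?thesis using E(1)[of k i] by simp
    next
      fix i k assume "a = Inr i" "b = Inr k"
      then show ?thesis using E(2)[of i k] by simp
    qed
  qed
qed

lemma subspace_sp: "module.subspace mscale sp"
proof -
  interpret vector_space mscale by (rule vector_space_mscale)
  show ?thesis by (rule subspaceI) (simp_all add: sp_iff mscale_def)
qed

lemma sp_vecs:
  "gl_vec i k \<in> sp" "upper_vec i k \<in> sp" "lower_vec i k \<in> sp"
  "matrix_unit (Inl i) (Inr i) \<in> sp" "matrix_unit (Inr i) (Inl i) \<in> sp"
  unfolding sp_iff by (simp_all add: matrix_unit_def conj_commute)

lemma gl_vec_cartan: "gl_vec i i \<in> cartan"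
  by (simp add: cartan_def sp_vecs) (auto simp: matrix_unit_def)

lemma subspace_cartan: "module.subspace mscale cartan"
proof -
  interpret vector_space mscale by (rule vector_space_mscale)
  show ?thesis by (rule subspaceI) (auto simp: cartan_def sp_iff mscale_def)
qed

lemma sum_delta_pair:
  fixes g :: "'a::finite \<Rightarrow> 'a \<Rightarrow> 'b::field"
  shows "(\<Sum>i\<in>UNIV. \<Sum>k\<in>UNIV. g i k * (if a = i \<and> b = k then 1 else 0) / c) = g a b / c"
    and "(\<Sum>i\<in>UNIV. \<Sum>k\<in>UNIV. g i k * (if a = k \<and> b = i then 1 else 0) / c) = g b a / c"
proof -
  have *: "(\<Sum>i\<in>UNIV. \<Sum>k\<in>UNIV. g i k * (if a = i \<and> b = k then 1 else 0) / c) = g a b / c" for a b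
  proof -
    have "(\<Sum>k\<in>UNIV. g i k * (if a = i \<and> b = k then 1 else 0) / c) = (if a = i then g i b / c else 0)" for i
      by (simp add: if_distrib[of "\<lambda>x. _ * x"] if_distrib[of "\<lambda>x. x / _"] cong: if_cong)
    then show ?thesis by simp
  qed
  from *[of a b] show "(\<Sum>i\<in>UNIV. \<Sum>k\<in>UNIV. g i k * (if a = i \<and> b = k then 1 else 0) / c) = g a b / c" .
  from *[of b a] show "(\<Sum>i\<in>UNIV. \<Sum>k\<in>UNIV. g i k * (if a = k \<and> b = i then 1 else 0) / c) = g b a / c"
    by (simp add: conj_commute)
qed

text \<open>The halves compensate for the double sum, which meets each symmetric pair twice, and for
  the doubling of the long root vectors at \<open>i = k\<close>.\<close>

lemma sp_decomposition:
  assumes "X \<in> sp"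
  shows "X = (\<Sum>i\<in>UNIV. \<Sum>k\<in>UNIV. mscale (X $ Inl i $ Inl k) (gl_vec i k)
      + mscale (X $ Inl i $ Inr k / 2) (upper_vec i k)
      + mscale (X $ Inr i $ Inl k / 2) (lower_vec i k))" (is "X = ?Y")
proof -
  have X: "X $ Inr a $ Inr b = - (X $ Inl b $ Inl a)"
    "X $ Inl a $ Inr b = X $ Inl b $ Inr a" "X $ Inr a $ Inl b = X $ Inr b $ Inl a" for a b
    using assms unfolding sp_iff by blast+
  \<comment> \<open>The off-diagonal blocks come out as averages of two entries that the symmetry in
    \<open>X\<close> identifies.\<close>
  have Y: "?Y $ r $ s = (case r of
      Inl a \<Rightarrow> (case s of Inl b \<Rightarrow> X $ Inl a $ Inl b | Inr b \<Rightarrow> X $ Inl a $ Inr b / 2 + X $ Inl b $ Inr a / 2)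
    | Inr a \<Rightarrow> (case s of Inl b \<Rightarrow> X $ Inr a $ Inl b / 2 + X $ Inr b $ Inl a / 2 | Inr b \<Rightarrow> - (X $ Inl b $ Inl a)))"
    for r s
    by (cases r; cases s)
      (simp_all add: mscale_def matrix_unit_def distrib_left right_diff_distrib
        sum.distrib sum_subtractf sum_negf sum_delta_pair sum_delta_pair[where c = 1, simplified]
        del: mult_delta_right)
  show ?thesis
    unfolding vec_eq_iff Y using X(1)
    by (auto simp: X(2,3)[symmetric] split: sum.split)
qed


section \<open>The sl2-triples of the positive roots\<close>

lemma matrix_add_rdistrib: "(A + B) ** C = A ** C + B ** C"
  for A B :: "'a::semiring_1 ^ 'n ^ 'm" and C :: "'a ^ 'k ^ 'n"
  by (simp add: matrix_matrix_mult_def vec_eq_iff distrib_right sum.distrib)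

lemmas matrix_unit_bracket_simps =
  bracket_def mat_diffs matrix_add_ldistrib matrix_add_rdistrib matrix_unit_mult

lemma gl_vec_triple:
  assumes "i \<noteq> k"
  shows "bracket (gl_vec i k) (gl_vec k i) = gl_vec i i - gl_vec k k"
    and "bracket (gl_vec i i - gl_vec k k) (gl_vec k i) = mscale (- 2) (gl_vec k i)"
  using assms by (simp_all add: matrix_unit_bracket_simps) (simp add: vec_eq_iff mscale_def)

text \<open>At \<open>i = k\<close> both vectors double and the bracket becomes \<open>4\<close>
  times the coroot, so the long roots get a triple of their own.\<close>

lemma upper_lower_triple:
  assumes "i \<noteq> k"
  shows "bracket (upper_vec i k) (lower_vec i k) = gl_vec i i + gl_vec k k"
    and "bracket (gl_vec i i + gl_vec k k) (lower_vec i k) = mscale (- 2) (lower_vec i k)"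
  using assms by (simp_all add: matrix_unit_bracket_simps) (simp add: vec_eq_iff mscale_def)

lemma long_root_triple:
  shows "bracket (matrix_unit (Inl i) (Inr i)) (matrix_unit (Inr i) (Inl i)) = gl_vec i i"
    and "bracket (gl_vec i i) (matrix_unit (Inr i) (Inl i)) =
      mscale (- 2) (matrix_unit (Inr i) (Inl i))"
  by (simp_all add: matrix_unit_bracket_simps) (simp add: vec_eq_iff mscale_def)

text \<open>The annihilator of \<open>w\<close> in \<open>sp\<close> is a subspace containing the
  Cartan subalgebra, because the weight is 0, and the positive root vectors. The sl2 lemma adds the
  negative root vectors one triple at a time.\<close>

lemma (in voa_module) weight_zero_vector_invariant:
  fixes J :: "'n::{finite,linorder} mat2 \<Rightarrow> 'v"
  assumes gr: "grading_restricted_generalized_module V M"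
    and J_wt: "\<And>x. x \<in> sp \<Longrightarrow> J x \<in> weight_space V 1"
    and J_add: "\<And>x y. x \<in> sp \<Longrightarrow> y \<in> sp \<Longrightarrow> J (x + y) = J x + J y"
    and J_scale: "\<And>c x. x \<in> sp \<Longrightarrow> J (mscale c x) = scal V c (J x)"
    and hw: "highest_weight_vector k M J (\<lambda>_. 0) w"
    and X: "X \<in> sp"
  shows "act M (J X) 0 w = 0"
proof -
  interpret ms: vector_space "mscale :: complex \<Rightarrow> 'n mat2 \<Rightarrow> 'n mat2"
    by (rule vector_space_mscale)
  \<comment> \<open>The central term carries the mode index as a factor, so it vanishes on zero
    modes.\<close>
  have rel: "act M (J x) 0 (act M (J y) 0 z) = act M (J y) 0 (act M (J x) 0 z) + act M (J (bracket x y)) 0 z"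
    if "x \<in> sp" "y \<in> sp" for x y z
  proof -
    have "act M (J x) 0 (act M (J y) 0 z) - act M (J y) 0 (act M (J x) 0 z)
     = act M (J (bracket x y)) (0 + 0) z
       + (if 0 + 0 = (0::int) then scal M (of_int 0 * sp_form x y * k) z else 0)"
      using hw that unfolding highest_weight_vector_def affine_relations_def by blast
    then show ?thesis by (simp add: algebra_simps)
  qed
  \<comment> \<open>Membership in \<open>sp\<close> is built in because \<open>J\<close> is linear
    only there.\<close>
  define N where "N = {x \<in> sp. act M (J x) 0 w = 0}"
  have N: "ms.subspace N"
  proof (rule ms.subspaceI)
    have "(0 :: 'n mat2) \<in> sp" by (rule ms.subspace_0[OF subspace_sp])
    moreover from this have "J 0 = 0" using J_add[of 0 0] by simp
    ultimately show "0 \<in> N" by (simp add: N_def)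
  next
    fix x y assume "x \<in> N" "y \<in> N"
    then show "x + y \<in> N"
      using ms.subspace_add[OF subspace_sp] by (simp add: N_def J_add act_left.add)
  next
    fix c x assume "x \<in> N"
    then show "mscale c x \<in> N"
      using ms.subspace_scale[OF subspace_sp] by (simp add: N_def J_scale act_left.scale)
  qed
  have cartan_N: "h \<in> N" if "h \<in> cartan" for h
    using hw that by (simp add: N_def highest_weight_vector_def cartan_def)
  have pos_N: "x \<in> N" if "x \<in> positive_root_vectors" "x \<in> sp" for x
    using hw that by (simp add: N_def highest_weight_vector_def)
  have lowering: "f \<in> N"
    if e: "e \<in> N" and f: "f \<in> sp" and ef: "bracket e f = h" and hf: "bracket h f = mscale (- 2) f"
      and h: "h \<in> cartan" for e f h
  proof -
    have sp: "e \<in> sp" "h \<in> sp" using e h by (auto simp: N_def cartan_def)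
    obtain B where B: "finite B" "\<And>i. (act M (J f) 0 ^^ i) w \<in> M.span B"
      using zero_mode_locally_finite[OF gr J_wt[OF f]] by blast
    have "act M (J f) 0 w = 0"
    proof (rule M.sl2_weight_zero_lowering_trivial[OF linear_act linear_act linear_act _ _ _ _ B])
      show "act M (J e) 0 (act M (J f) 0 x) = act M (J f) 0 (act M (J e) 0 x) + act M (J h) 0 x" for x
        using rel[OF sp(1) f] ef by simp
      show "act M (J h) 0 (act M (J f) 0 x) = act M (J f) 0 (act M (J h) 0 x) - scal M 2 (act M (J f) 0 x)" for x
        using rel[OF sp(2) f, of x] unfolding hf J_scale[OF f] act_left.scale by simp
      show "act M (J e) 0 w = 0" "act M (J h) 0 w = 0"
        using e cartan_N[OF h] by (simp_all add: N_def)
    qed simp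
    then show ?thesis using f by (simp add: N_def)
  qed
  have gl_cartan: "gl_vec i i - gl_vec k k \<in> cartan" "gl_vec i i + gl_vec k k \<in> cartan"
    for i k :: 'n
    by (intro ms.subspace_diff[OF subspace_cartan] ms.subspace_add[OF subspace_cartan]
        gl_vec_cartan)+
  have gl_pos: "gl_vec i k \<in> N" if "i < k" for i k :: 'n
    using that by (intro pos_N sp_vecs) (auto simp: positive_root_vectors_def)
  have gl_N: "gl_vec i k \<in> N" for i k :: 'n
  proof (cases i k rule: linorder_cases)
    case less then show ?thesis by (rule gl_pos)
  next
    case equal then show ?thesis by (simp add: cartan_N gl_vec_cartan)
  next
    case greater
    then have "k \<noteq> i" by simp
    show ?thesis
      by (rule lowering[OF gl_pos[OF greater] sp_vecs(1) gl_vec_triple[OF \<open>k \<noteq> i\<close>] gl_cartan(1)])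
  qed
  have long_N: "matrix_unit (Inl i) (Inr i) \<in> N" for i :: 'n
    by (intro pos_N sp_vecs) (auto simp: positive_root_vectors_def)
  have long_lower_N: "matrix_unit (Inr i) (Inl i) \<in> N" for i :: 'n
    by (rule lowering[OF long_N sp_vecs(5) long_root_triple gl_vec_cartan])
  have upper_pos: "upper_vec i k \<in> N" if "i < k" for i k :: 'n
    using that by (intro pos_N sp_vecs) (auto simp: positive_root_vectors_def)
  have upper_N: "upper_vec i k \<in> N" for i k :: 'n
  proof (cases i k rule: linorder_cases)
    case equal
    show ?thesis unfolding equal by (rule ms.subspace_add[OF N long_N long_N])
  next
    case greater
    then show ?thesis using upper_pos[of k i] by (simp add: add.commute)
  qed (rule upper_pos)
  have lower_neg: "lower_vec i k \<in> N" if "i \<noteq> k" for i k :: 'n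
    by (rule lowering[OF upper_N sp_vecs(3) upper_lower_triple[OF that] gl_cartan(2)])
  \<comment> \<open>On the diagonal, \<open>lower_vec i i\<close> is the sum of two copies of a long
    root vector.\<close>
  have lower_N: "lower_vec i k \<in> N" for i k :: 'n
    using lower_neg[of i k] ms.subspace_add[OF N long_lower_N[of i] long_lower_N[of i]] by metis
  have "X \<in> N"
    by (subst sp_decomposition[OF X])
      (intro ms.subspace_sum[OF N] ms.subspace_add[OF N] ms.subspace_scale[OF N]
        gl_N upper_N lower_N)
  then show ?thesis by (simp add: N_def)
qed

theorem proposition6p3:
  fixes V :: "'u::ab_group_add voa"
    and j :: "'n::{finite,linorder} mat2 \<Rightarrow> 'u"
    and L :: "'v::ab_group_add voa"
    and p :: "'u \<Rightarrow> 'v"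
    and M :: "('v, 'w::ab_group_add) voa_mod"
  assumes "CARD('n) \<ge> 2"
    and "simple_affine_voa (- 1) V j L p"
    and "grading_restricted_generalized_module L M"
    and "highest_weight_module (- 1) L M (p \<circ> j) (\<lambda>_. 0)"
  shows "irreducible_module L M"
proof -
  have V: "universal_affine_voa (- 1) V j" and L: "simple_voa L" and p: "voa_hom V L p" "surj p"
    using assms(2) by (auto simp: simple_affine_voa_def)
  have axM: "module_axioms L M"
    using assms(3) by (simp add: grading_restricted_generalized_module_def)
  have "vector_space (scal L)"
    using L by (auto simp: simple_voa_def vertex_operator_algebra_def module_axioms_def)
  with axM interpret voa_module L M by unfold_locales (auto simp: vector_space_def)
  obtain w where hw: "highest_weight_vector (- 1) M (p \<circ> j) (\<lambda>_. 0) w"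
    and gen: "\<And>S. submodule L M S \<Longrightarrow> w \<in> S \<Longrightarrow> S = UNIV"
    using assms(4) unfolding highest_weight_module_def by blast
  have p_lin: "module_hom (scal V) (scal L) p"
    using p(1) unfolding voa_hom_def by (intro module_hom_linearI) blast
  have p_act: "p (act V u n v) = act L (p u) n (p v)" and p_vac: "p (vac V) = vac L"
    and p_conf: "p (conf V) = conf L" for u n v
    using p(1) by (simp_all add: voa_hom_def)
  have zero: "act M (p (j x)) 0 w = 0" if "x \<in> sp" for x
  proof -
    have "act M ((p \<circ> j) x) 0 w = 0"
    proof (rule weight_zero_vector_invariant[OF assms(3) _ _ _ hw that])
      fix x :: "'n mat2" assume "x \<in> sp"
      then have "p (act V (conf V) 1 (j x)) = p (j x)"
        using V by (simp add: universal_affine_voa_def weight_space_def virasoro_mode_def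
            module_hom.scale[OF p_lin])
      then show "(p \<circ> j) x \<in> weight_space L 1"
        by (simp add: weight_space_def virasoro_mode_def p_act p_conf)
    qed (use V in \<open>simp_all add: universal_affine_voa_def module_hom.add[OF p_lin]
        module_hom.scale[OF p_lin]\<close>)
    then show ?thesis by simp
  qed
  then have gens: "act M (p (j x)) n w = 0" if "x \<in> sp" "n \<ge> 0" for x n
    using that hw by (cases "n = 0") (auto simp: highest_weight_vector_def)
  define K where "K = {u. \<forall>n\<ge>0. act M u n w = 0}"
  have K: "V.subspace K"
    by (rule V.subspaceI) (auto simp: K_def act_left.zero act_left.add act_left.scale)
  have words: "p (apply_word V j ws) \<in> K" if "ws \<in> affine_words" for ws
    using that unfolding affine_words_def
  proof (induction ws)
    case Nil
    then show ?case by (simp add: apply_word_def p_vac K_def act_vac)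
  next
    case (Cons a ws)
    obtain x m where a: "a = (x, m)" "x \<in> sp" using Cons.hyps(1) by auto
    then have "p (apply_word V j (a # ws)) = act L (p (j x)) m (p (apply_word V j ws))"
      by (simp add: apply_word_def p_act)
    then show ?case
      using Cons.IH act_iterate_vanishing[OF gens[OF a(2)]] by (simp add: K_def)
  qed
  have "u \<in> K" for u
  proof -
    obtain v where v: "u = p v" using p(2) by blast
    obtain f where f: "Poly_Mapping.keys f \<subseteq> affine_words" "apply_comb V j f = v"
      using V unfolding universal_affine_voa_def is_vacuum_module_def by blast
    have "u = (\<Sum>ws\<in>Poly_Mapping.keys f. scal L (Poly_Mapping.lookup f ws) (p (apply_word V j ws)))"
      unfolding v f(2)[symmetric] apply_comb_def
      by (simp add: module_hom.sum[OF p_lin] module_hom.scale[OF p_lin])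
    also have "\<dots> \<in> K"
      using f(1) by (intro V.subspace_sum[OF K] V.subspace_scale[OF K] words) auto
    finally show ?thesis .
  qed
  then have "act M u n w = 0" if "n \<ge> 0" for u n using that by (auto simp: K_def)
  moreover have "w \<noteq> 0" using hw by (simp add: highest_weight_vector_def)
  ultimately show ?thesis
    using irreducible_if_generated_by_vacuum_like[OF L axM _ _ gen] by blast
qed

end
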